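(* Let $F\colon \mathbb{N} \to (\mathbb{N}\setminus\{0\})\cup\{\infty\}$. If $\lim_{n\to\infty} F(n) = \infty$, then there is a perfect $\Pi^0_1(F)$ (i.e., effectively-in-$F$ closed) maximal eventually different family in $\mathcal{N}_F$.
   Context: For $F\colon \mathbb{N}\to\mathbb{N}\cup\{\infty\}$, let $\mathcal{N}_F = \{g \in {}^{\mathbb{N}}\mathbb{N} \mid (\forall n\in\mathbb{N})\; g(n) < F(n)\}$, where $k<\infty$ for all $k\in\mathbb{N}$, with the product topology of the discrete spaces $\{k\in\mathbb{N}\mid k<F(n)\}$. The set $\mathbb{N}\cup\{\infty\}$ carries the order topology, so $\lim_{n\to\infty}F(n)=\infty$ means that for every $k\in\mathbb{N}$, $F(n)\geq k$ for all but finitely many $n$ (the value $\infty$ is allowed). Two functions $g_0,g_1$ with domain $\mathbb{N}$ are eventually different if $\{n\in\mathbb{N}\mid g_0(n)=g_1(n)\}$ is finite. A set $\mathcal{E}$ is an eventually different family in $\mathcal{N}_F$ if $\mathcal{E}\subseteq\mathcal{N}_F$ and any two distinct elements of $\mathcal{E}$ are eventually different; it is maximal if it is maximal under inclusion among eventually different families in $\mathcal{N}_F$. A set is $\Pi^0_1(F)$ if it is the set $[T]$ of infinite branches of a tree $T$ of finite sequences of natural numbers that is recursive in $F$, where $F$ is regarded as an oracle by coding the value $\infty$ by a fixed symbol that is not a natural number. A set is perfect if it is nonempty, closed and has no isolated points. *)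

theory Defs
  imports "HOL-Analysis.Analysis" "HOL-Library.Nat_Bijection" "HOL-Library.Sublist"
begin

text \<open>Oracle computability: the total functions recursive in \<open>h\<close> form the least class containing
  \<open>h\<close> and the basic functions that is closed under composition, primitive recursion and minimization
  of regular functions. \<open>recursive_in h n f\<close> says that \<open>f\<close>, as an \<open>n\<close>-ary function, is in this
  class. The arguments of an \<open>n\<close>-ary function are passed as a list of length \<open>n\<close>; its values on lists
  of other lengths are irrelevant, whence the rule \<open>ext\<close>.\<close>

inductive recursive_in :: "(nat \<Rightarrow> nat) \<Rightarrow> nat \<Rightarrow> (nat list \<Rightarrow> nat) \<Rightarrow> bool" for h where
  zero: "recursive_in h n (\<lambda>xs. 0)"
| succ: "recursive_in h 1 (\<lambda>xs. Suc (xs ! 0))"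
| proj: "i < n \<Longrightarrow> recursive_in h n (\<lambda>xs. xs ! i)"
| orac: "recursive_in h 1 (\<lambda>xs. h (xs ! 0))"
| comp: "recursive_in h (length gs) f \<Longrightarrow> \<forall>g\<in>set gs. recursive_in h n g \<Longrightarrow>
    recursive_in h n (\<lambda>xs. f (map (\<lambda>g. g xs) gs))"
| prim_rec: "recursive_in h n f \<Longrightarrow> recursive_in h (n + 2) g \<Longrightarrow>
    recursive_in h (Suc n) (\<lambda>xs. rec_nat (f (tl xs)) (\<lambda>k r. g (k # r # tl xs)) (hd xs))"
| mu: "recursive_in h (Suc n) f \<Longrightarrow> \<forall>xs. length xs = n \<longrightarrow> (\<exists>y. f (y # xs) = 0) \<Longrightarrow>
    recursive_in h n (\<lambda>xs. LEAST y. f (y # xs) = 0)"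
| ext: "recursive_in h n f \<Longrightarrow> \<forall>xs. length xs = n \<longrightarrow> g xs = f xs \<Longrightarrow> recursive_in h n g"

definition recursive_set_in :: "(nat \<Rightarrow> nat) \<Rightarrow> nat set \<Rightarrow> bool" where
  "recursive_set_in h A \<longleftrightarrow> recursive_in h 1 (\<lambda>xs. of_bool (xs ! 0 \<in> A))"

definition seq_tree :: "nat list set \<Rightarrow> bool" where
  "seq_tree T \<longleftrightarrow> (\<forall>t\<in>T. \<forall>s. prefix s t \<longrightarrow> s \<in> T)"

definition branches :: "nat list set \<Rightarrow> (nat \<Rightarrow> nat) set" where
  "branches T = {g. \<forall>n. map g [0..<n] \<in> T}"

text \<open>Finite sequences are coded as numbers by the library's (recursive) bijection \<open>list_encode\<close>.\<close>

definition Pi01_in :: "(nat \<Rightarrow> nat) \<Rightarrow> (nat \<Rightarrow> nat) set \<Rightarrow> bool" where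
  "Pi01_in h S \<longleftrightarrow> (\<exists>T. seq_tree T \<and> recursive_set_in h (list_encode ` T) \<and> S = branches T)"

text \<open>Oracles being number-valued, the symbol for \<open>\<infinity>\<close> is \<open>0\<close>, and \<open>k\<close> is represented by \<open>k + 1\<close>.\<close>

definition enat_oracle :: "(nat \<Rightarrow> enat) \<Rightarrow> nat \<Rightarrow> nat" where
  "enat_oracle F n = (case F n of enat k \<Rightarrow> Suc k | \<infinity> \<Rightarrow> 0)"

definition NF :: "(nat \<Rightarrow> enat) \<Rightarrow> (nat \<Rightarrow> nat) set" where
  "NF F = {g. \<forall>n. enat (g n) < F n}"

definition NF_topology :: "(nat \<Rightarrow> enat) \<Rightarrow> (nat \<Rightarrow> nat) topology" where
  "NF_topology F = product_topology (\<lambda>n. discrete_topology {k. enat k < F n}) UNIV"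

lemma topspace_NF_topology: "topspace (NF_topology F) = NF F"
  by (auto simp: NF_topology_def NF_def PiE_def Pi_def)

definition perfect_in :: "'a topology \<Rightarrow> 'a set \<Rightarrow> bool" where
  "perfect_in X S \<longleftrightarrow>
    S \<noteq> {} \<and> closedin X S \<and> (\<forall>x\<in>S. \<not> openin (subtopology X S) {x})"

definition eventually_different :: "(nat \<Rightarrow> 'a) \<Rightarrow> (nat \<Rightarrow> 'a) \<Rightarrow> bool" where
  "eventually_different g0 g1 \<longleftrightarrow> finite {n. g0 n = g1 n}"

definition ev_diff_family :: "(nat \<Rightarrow> enat) \<Rightarrow> (nat \<Rightarrow> nat) set \<Rightarrow> bool" where
  "ev_diff_family F E \<longleftrightarrow> E \<subseteq> NF F \<and> pairwise eventually_different E"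

definition maximal_ev_diff_family :: "(nat \<Rightarrow> enat) \<Rightarrow> (nat \<Rightarrow> nat) set \<Rightarrow> bool" where
  "maximal_ev_diff_family F E \<longleftrightarrow>
    ev_diff_family F E \<and> (\<forall>E'. ev_diff_family F E' \<and> E \<subseteq> E' \<longrightarrow> E' = E)"

end

theory Submission
  imports Defs
begin

text \<open>
Let \<open>k n\<close> be about the binary logarithm of \<open>F n\<close>, but at most \<open>n\<close>; then \<open>k\<close> tends to infinity.
For \<open>Y \<subseteq> \<nat>\<close> let \<open>code Y n\<close> be the number with binary expansion \<open>Y \<inter> {..<k n}\<close>. It lies below
\<open>2 ^ k n \<le> F n\<close>, and different sets have eventually different codes. The family consists of one
function \<open>member Y\<close> for every set \<open>Y\<close>; it is \<open>code Y\<close> except at certain arguments, where the value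
is changed to achieve maximality.

The set \<open>Y\<close> is read as a pair: its odd elements give a set \<open>G\<close> of pairs, thought of as the graph of
a function \<open>f\<close>, and its even elements give a set of indices, thought of as a singleton \<open>{s}\<close>.
Changes, always to the value \<open>f n\<close>, take place only at the spots \<open>n\<close> of \<open>G\<close>, which are numbers that
encode initial segments of \<open>G\<close>. So sets with different graph parts have almost disjoint sets of
changes. Two things can still go wrong: \<open>f n\<close> may equal \<open>code Z n\<close> for infinitely many changes \<open>n\<close>,
and sets with the same graph part might be changed at the same places. Both are avoided by a forest
on the spots of \<open>G\<close>: say that \<open>m\<close> is below \<open>n\<close> if \<open>f m\<close> is a truncation of \<open>f n\<close>, and let the
parent of \<open>n\<close> be the largest such \<open>m\<close>. A change is made at \<open>n\<close> only if the parent of \<open>n\<close> is the one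
named by \<open>s\<close>. If \<open>f\<close> agrees with \<open>code Z\<close> at \<open>m\<close> and at a later \<open>n\<close> with \<open>k m \<le> k n\<close>, then \<open>m\<close> is below
\<open>n\<close>, so the parent of \<open>n\<close> is at least \<open>m\<close>; this cannot happen for unboundedly many \<open>m\<close> if the
parent is always the same (\<open>finite_override_code\<close>). And children of different parents are different
(\<open>finite_override_common\<close>).

For maximality (\<open>infinite_agreement\<close>), take any \<open>f\<close> in the space and let \<open>G\<close> be its graph. If some
parent \<open>s\<close> has infinitely many children, the set \<open>Y\<close> given by \<open>G\<close> and \<open>s\<close> has a \<open>member Y\<close> that agrees
with \<open>f\<close> at all of them. Otherwise the forest is finitely branching and has an infinite path. The
values of \<open>f\<close> along the path are truncations of a single set \<open>Y\<close>, so \<open>f\<close> agrees with \<open>code Y\<close> there.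
If \<open>G\<close> is the graph part of \<open>Y\<close>, then the changes in \<open>member Y\<close> are to values of \<open>f\<close>; if not, only
finitely many of them are made on the path. In both cases \<open>f\<close> and \<open>member Y\<close> agree infinitely often.

The family is effectively closed (\<open>branches_tree\<close>) because \<open>G\<close> may be any set of pairs: whether
\<open>(n, v)\<close> is a change prescribed by \<open>Y\<close> depends on a part of \<open>Y\<close> that is bounded in terms of \<open>n\<close> and
\<open>v\<close> (\<open>override_cong\<close>), even though it cannot be decided whether there is such a \<open>v\<close> for a given \<open>n\<close>.
That \<open>h = member Y\<close> then says, for all \<open>n\<close> and \<open>v\<close>, that \<open>h n = v\<close> if \<open>(n, v)\<close> is a change and
\<open>h n = code Y n\<close> if \<open>(n, h n)\<close> is not a change. As spots are even, \<open>Y\<close> can be read off from the odd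
arguments of \<open>h\<close>.
\<close>

section \<open>Recursive functions and decidable relations\<close>

text \<open>The arguments of relations and functions are written \<open>xs ! 0\<close>, \<open>xs ! 1\<close>, and so on; a bound
  variable becomes a new last argument. The rules below then decompose a goal along the syntax of
  the term, and the side conditions \<open>ext\<close> say that the body of a binder only looks at the arguments
  that are in scope.\<close>
definition decidable_in :: "(nat \<Rightarrow> nat) \<Rightarrow> nat \<Rightarrow> (nat list \<Rightarrow> bool) \<Rightarrow> bool" where
  "decidable_in h n P \<longleftrightarrow> recursive_in h n (\<lambda>xs. of_bool (P xs))"

lemma rec_reindex:
  assumes "recursive_in h (length js) f" "\<forall>j\<in>set js. j < n"
  shows "recursive_in h n (\<lambda>xs. f (map ((!) xs) js))"
proof -
  have "recursive_in h n (\<lambda>xs. f (map (\<lambda>g. g xs) (map (\<lambda>j xs. xs ! j) js)))"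
    using assms by (intro recursive_in.comp) (auto intro: recursive_in.proj)
  then show ?thesis by (simp add: comp_def)
qed

lemma rec_comp1:
  assumes "recursive_in h 1 (\<lambda>xs. f (xs ! 0))" "recursive_in h n a"
  shows "recursive_in h n (\<lambda>xs. f (a xs))"
  using recursive_in.comp[of h "[a]" "\<lambda>xs. f (xs ! 0)" n] assms by simp

lemma rec_comp2:
  assumes "recursive_in h 2 (\<lambda>xs. f (xs ! 0) (xs ! 1))" "recursive_in h n a" "recursive_in h n b"
  shows "recursive_in h n (\<lambda>xs. f (a xs) (b xs))"
  using recursive_in.comp[of h "[a, b]" "\<lambda>xs. f (xs ! 0) (xs ! 1)" n] assms
  by (simp add: numeral_2_eq_2)

lemma dec_comp2:
  assumes "decidable_in h 2 (\<lambda>xs. P (xs ! 0) (xs ! 1))" "recursive_in h n a" "recursive_in h n b"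
  shows "decidable_in h n (\<lambda>xs. P (a xs) (b xs))"
  using rec_comp2[of h "\<lambda>x y. of_bool (P x y)"] assms unfolding decidable_in_def by blast

lemma dec_comp3:
  assumes "decidable_in h 3 (\<lambda>xs. P (xs ! 0) (xs ! 1) (xs ! 2))"
    "recursive_in h n a" "recursive_in h n b" "recursive_in h n c"
  shows "decidable_in h n (\<lambda>xs. P (a xs) (b xs) (c xs))"
  using recursive_in.comp[of h "[a, b, c]" "\<lambda>xs. of_bool (P (xs ! 0) (xs ! 1) (xs ! 2))" n] assms
  by (simp add: numeral_3_eq_3 numeral_2_eq_2 decidable_in_def)

lemma rec_Suc: "recursive_in h n a \<Longrightarrow> recursive_in h n (\<lambda>xs. Suc (a xs))"
  using rec_comp1[OF recursive_in.succ] .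

lemma rec_oracle: "recursive_in h n a \<Longrightarrow> recursive_in h n (\<lambda>xs. h (a xs))"
  using rec_comp1[OF recursive_in.orac] .

lemma rec_const: "recursive_in h n (\<lambda>xs. c)"
  by (induction c) (auto intro: recursive_in.zero rec_Suc)

text \<open>Primitive recursion puts the counter and the previous value before the parameters, whence the
  reindexing to the convention that new variables come last.\<close>
lemma rec_rec_nat:
  assumes a: "recursive_in h n a"
    and g: "recursive_in h (n + 2) (\<lambda>xs. g xs (xs ! n) (xs ! Suc n))"
    and b: "recursive_in h n b"
    and ext: "\<And>xs k r. length xs = n \<Longrightarrow> g (xs @ [k, r]) k r = g xs k r"
  shows "recursive_in h n (\<lambda>xs. rec_nat (a xs) (\<lambda>k r. g xs k r) (b xs))"
proof -
  define g' where "g' = (\<lambda>ys. (\<lambda>xs. g xs (xs ! n) (xs ! Suc n)) (map ((!) ys) ([2..<n+2] @ [0, 1])))"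
  have g': "recursive_in h (n + 2) g'"
    unfolding g'_def
  proof (rule rec_reindex)
    show "recursive_in h (length ([2..<n+2] @ [0, 1::nat])) (\<lambda>xs. g xs (xs ! n) (xs ! Suc n))"
      using g by (simp del: upt_Suc)
  qed (auto simp del: upt_Suc)
  define f where "f = (\<lambda>xs. rec_nat (a (tl xs)) (\<lambda>k r. g' (k # r # tl xs)) (hd xs))"
  have f: "recursive_in h (Suc n) f"
    unfolding f_def by (rule recursive_in.prim_rec[OF a g'])
  let ?gs = "b # map (\<lambda>j xs. xs ! j) [0..<n]"
  have "recursive_in h n (\<lambda>xs. f (map (\<lambda>g. g xs) ?gs))"
    using f b by (intro recursive_in.comp) (auto intro: recursive_in.proj)
  then show ?thesis
  proof (rule recursive_in.ext, intro allI impI)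
    fix xs :: "nat list" assume len: "length xs = n"
    have "map (\<lambda>g. g xs) ?gs = b xs # xs"
      using len map_nth[of xs] by (simp add: comp_def)
    moreover have "g' (k # r # xs) = g xs k r" for k r
    proof -
      have "map ((!) (k # r # xs)) [2..<n+2] = xs"
        using len by (intro nth_equalityI) (simp_all del: upt_Suc)
      then have eq: "map ((!) (k # r # xs)) ([2..<n+2] @ [0, 1]) = xs @ [k, r]" by simp
      show ?thesis
        unfolding g'_def eq using ext[OF len, of k r] len by (simp add: nth_append)
    qed
    ultimately show "rec_nat (a xs) (\<lambda>k r. g xs k r) (b xs) = f (map (\<lambda>g. g xs) ?gs)"
      by (simp add: f_def)
  qed
qed

lemma rec_plus:
  assumes "recursive_in h n a" "recursive_in h n b"
  shows "recursive_in h n (\<lambda>xs. a xs + b xs)"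
proof -
  have "recursive_in h 2 (\<lambda>xs. rec_nat (xs ! 1) (\<lambda>k r. Suc r) (xs ! 0))"
    by (intro rec_rec_nat rec_Suc recursive_in.proj) auto
  moreover have "rec_nat y (\<lambda>k r. Suc r) x = x + y" for x y :: nat by (induction x) auto
  ultimately have "recursive_in h 2 (\<lambda>xs. xs ! 0 + xs ! 1)" by simp
  then show ?thesis using assms by (rule rec_comp2)
qed

lemma rec_times:
  assumes "recursive_in h n a" "recursive_in h n b"
  shows "recursive_in h n (\<lambda>xs. a xs * b xs)"
proof -
  have "recursive_in h 2 (\<lambda>xs. rec_nat 0 (\<lambda>k r. r + xs ! 1) (xs ! 0))"
    by (intro rec_rec_nat rec_plus rec_const recursive_in.proj) (auto simp: nth_append)
  moreover have "rec_nat 0 (\<lambda>k r. r + y) x = x * y" for x y :: nat by (induction x) auto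
  ultimately have "recursive_in h 2 (\<lambda>xs. xs ! 0 * xs ! 1)" by simp
  then show ?thesis using assms by (rule rec_comp2)
qed

lemma rec_power:
  assumes "recursive_in h n a" "recursive_in h n b"
  shows "recursive_in h n (\<lambda>xs. a xs ^ b xs)"
proof -
  have "recursive_in h 2 (\<lambda>xs. rec_nat 1 (\<lambda>k r. r * xs ! 0) (xs ! 1))"
    by (intro rec_rec_nat rec_times rec_const recursive_in.proj) (auto simp: nth_append)
  moreover have "rec_nat 1 (\<lambda>k r. r * x) y = x ^ y" for x y :: nat by (induction y) auto
  ultimately have "recursive_in h 2 (\<lambda>xs. xs ! 0 ^ xs ! 1)" by simp
  then show ?thesis using assms by (rule rec_comp2)
qed

lemma rec_minus:
  assumes "recursive_in h n a" "recursive_in h n b"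
  shows "recursive_in h n (\<lambda>xs. a xs - b xs)"
proof -
  have "recursive_in h 1 (\<lambda>xs. rec_nat 0 (\<lambda>k r. k) (xs ! 0))"
    by (intro rec_rec_nat rec_const recursive_in.proj) auto
  moreover have "rec_nat 0 (\<lambda>k r. k) x = x - 1" for x :: nat by (cases x) auto
  ultimately have pred: "recursive_in h 1 (\<lambda>xs. xs ! 0 - 1)" by simp
  have "recursive_in h 2 (\<lambda>xs. rec_nat (xs ! 0) (\<lambda>k r. r - 1) (xs ! 1))"
    by (intro rec_rec_nat rec_comp1[OF pred] recursive_in.proj) (auto simp: nth_append)
  moreover have "rec_nat x (\<lambda>k r. r - 1) y = x - y" for x y :: nat by (induction y) auto
  ultimately have "recursive_in h 2 (\<lambda>xs. xs ! 0 - xs ! 1)" by simp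
  then show ?thesis using assms by (rule rec_comp2)
qed

lemma dec_le:
  assumes "recursive_in h n a" "recursive_in h n b"
  shows "decidable_in h n (\<lambda>xs. a xs \<le> b xs)"
proof -
  have "recursive_in h n (\<lambda>xs. 1 - (a xs - b xs))"
    using assms by (intro rec_minus rec_const)
  moreover have "(1::nat) - (x - y) = of_bool (x \<le> y)" for x y by auto
  ultimately show ?thesis by (simp add: decidable_in_def)
qed

lemma dec_not:
  assumes "decidable_in h n P"
  shows "decidable_in h n (\<lambda>xs. \<not> P xs)"
proof -
  have "recursive_in h n (\<lambda>xs. 1 - of_bool (P xs))"
    using assms unfolding decidable_in_def by (intro rec_minus rec_const)
  moreover have "(1::nat) - of_bool b = of_bool (\<not> b)" for b by simp
  ultimately show ?thesis by (simp only: decidable_in_def)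
qed

lemma dec_conj:
  assumes "decidable_in h n P" "decidable_in h n Q"
  shows "decidable_in h n (\<lambda>xs. P xs \<and> Q xs)"
proof -
  have "recursive_in h n (\<lambda>xs. of_bool (P xs) * of_bool (Q xs))"
    using assms unfolding decidable_in_def by (intro rec_times)
  then show ?thesis by (simp add: decidable_in_def of_bool_conj)
qed

lemma dec_disj:
  assumes "decidable_in h n P" "decidable_in h n Q"
  shows "decidable_in h n (\<lambda>xs. P xs \<or> Q xs)"
proof -
  have "decidable_in h n (\<lambda>xs. \<not> (\<not> P xs \<and> \<not> Q xs))"
    using assms by (intro dec_not dec_conj)
  then show ?thesis by simp
qed

lemma dec_imp:
  assumes "decidable_in h n P" "decidable_in h n Q"
  shows "decidable_in h n (\<lambda>xs. P xs \<longrightarrow> Q xs)"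
  unfolding imp_conv_disj using assms by (intro dec_not dec_disj)

lemma dec_iff:
  assumes "decidable_in h n P" "decidable_in h n Q"
  shows "decidable_in h n (\<lambda>xs. P xs \<longleftrightarrow> Q xs)"
  unfolding iff_conv_conj_imp using assms by (intro dec_imp dec_conj)

lemma dec_less:
  assumes "recursive_in h n a" "recursive_in h n b"
  shows "decidable_in h n (\<lambda>xs. a xs < b xs)"
  unfolding less_le_not_le using assms by (intro dec_not dec_conj dec_le)

lemma dec_eq:
  fixes a b :: "nat list \<Rightarrow> nat"
  assumes "recursive_in h n a" "recursive_in h n b"
  shows "decidable_in h n (\<lambda>xs. a xs = b xs)"
  unfolding eq_iff using assms by (intro dec_conj dec_le)

text \<open>A bounded quantifier is a bounded product of truth values.\<close>
lemma dec_all_less: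
  assumes P: "decidable_in h (Suc n) (\<lambda>xs. P xs (xs ! n))"
    and b: "recursive_in h n b"
    and ext: "\<And>xs i. length xs = n \<Longrightarrow> P (xs @ [i]) i = P xs i"
  shows "decidable_in h n (\<lambda>xs. \<forall>i<b xs. P xs i)"
proof -
  let ?P = "\<lambda>xs. P (take n xs) (xs ! n)"
  have P': "recursive_in h (Suc n) (\<lambda>xs. of_bool (?P xs))"
    using P unfolding decidable_in_def
  proof (rule recursive_in.ext, intro allI impI)
    fix xs :: "nat list" assume "length xs = Suc n"
    then have "xs = take n xs @ [xs ! n]" "length (take n xs) = n"
      using take_Suc_conv_app_nth[of n xs] by auto
    then show "of_bool (P (take n xs) (xs ! n)) = of_bool (P xs (xs ! n))"
      using ext[of "take n xs" "xs ! n"] by simp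
  qed
  have "recursive_in h (n + 2) (\<lambda>xs. of_bool (?P (map ((!) xs) [0..<Suc n])))"
    using P' by (intro rec_reindex[where f = "\<lambda>xs. of_bool (?P xs)"]) (auto simp del: upt_Suc)
  then have "recursive_in h (n + 2) (\<lambda>xs. of_bool (?P xs))"
  proof (rule recursive_in.ext, intro allI impI)
    fix xs :: "nat list" assume "length xs = n + 2"
    then have "take n (map ((!) xs) [0..<Suc n]) = take n xs" "map ((!) xs) [0..<Suc n] ! n = xs ! n"
      by (auto intro!: nth_equalityI simp del: upt_Suc)
    then show "of_bool (?P xs) = of_bool (?P (map ((!) xs) [0..<Suc n]))" by (simp only:)
  qed
  then have "recursive_in h n (\<lambda>xs. rec_nat 1 (\<lambda>k r. of_bool (P (take n xs) k) * r) (b xs))"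
    using b by (intro rec_rec_nat rec_const rec_times recursive_in.proj) auto
  then show ?thesis unfolding decidable_in_def
  proof (rule recursive_in.ext, intro allI impI)
    fix xs :: "nat list" assume len: "length xs = n"
    have "rec_nat 1 (\<lambda>k r. of_bool (P xs k) * r) m = (of_bool (\<forall>i<m. P xs i) :: nat)" for m
      by (induction m) (auto simp: less_Suc_eq)
    then show "of_bool (\<forall>i<b xs. P xs i)
      = (rec_nat 1 (\<lambda>k r. of_bool (P (take n xs) k) * r) (b xs) :: nat)"
      using len by simp
  qed
qed

lemma dec_ex_less:
  assumes "decidable_in h (Suc n) (\<lambda>xs. P xs (xs ! n))" "recursive_in h n b"
    and "\<And>xs i. length xs = n \<Longrightarrow> P (xs @ [i]) i = P xs i"
  shows "decidable_in h n (\<lambda>xs. \<exists>i<b xs. P xs i)"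
proof -
  have "decidable_in h n (\<lambda>xs. \<not> (\<forall>i<b xs. \<not> P xs i))"
    using assms by (intro dec_not dec_all_less) simp_all
  then show ?thesis by simp
qed

lemma rec_Least:
  assumes P: "decidable_in h (Suc n) (\<lambda>xs. P xs (xs ! n))"
    and ex: "\<And>xs. length xs = n \<Longrightarrow> \<exists>y. P xs y"
    and ext: "\<And>xs i. length xs = n \<Longrightarrow> P (xs @ [i]) i = P xs i"
  shows "recursive_in h n (\<lambda>xs. LEAST y. P xs y)"
proof -
  define f where "f = (\<lambda>ys. of_bool (\<not> P (map ((!) ys) ([1..<Suc n] @ [0]))
    (map ((!) ys) ([1..<Suc n] @ [0]) ! n)) :: nat)"
  have "recursive_in h (Suc n) f"
    unfolding f_def using dec_not[OF P] unfolding decidable_in_def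
    by (intro rec_reindex[where f = "\<lambda>xs. of_bool (\<not> P xs (xs ! n))"]) (auto simp del: upt_Suc)
  moreover have f: "f (y # xs) = 0 \<longleftrightarrow> P xs y" if "length xs = n" for y xs
  proof -
    have "map ((!) (y # xs)) [1..<Suc n] = xs"
      using that by (intro nth_equalityI) (simp_all del: upt_Suc)
    then have eq: "map ((!) (y # xs)) ([1..<Suc n] @ [0]) = xs @ [y]" by simp
    show ?thesis
      unfolding f_def eq using ext[OF that, of y] that by (simp add: nth_append)
  qed
  ultimately have "recursive_in h n (\<lambda>xs. LEAST y. f (y # xs) = 0)"
    using ex by (intro recursive_in.mu) auto
  then show ?thesis by (rule recursive_in.ext) (simp add: f)
qed

lemmas rec_basic = rec_const recursive_in.proj rec_Suc rec_plus rec_times rec_power rec_minus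
  dec_le dec_less dec_eq dec_not dec_conj dec_disj dec_imp dec_iff dec_all_less dec_ex_less

lemma rec_div:
  assumes "recursive_in h n a" "recursive_in h n b"
  shows "recursive_in h n (\<lambda>xs. a xs div b xs)"
proof -
  have *: "(LEAST q. y = 0 \<or> x < y * Suc q) = x div y" for x y :: nat
  proof (cases "y = 0")
    case False
    then show ?thesis
      using dividend_less_times_div[of y x] less_mult_imp_div_less[of x _ y]
      by (intro Least_equality) (auto simp: mult.commute simp flip: less_Suc_eq_le)
  qed auto
  have "recursive_in h 2 (\<lambda>xs. LEAST q. xs ! 1 = 0 \<or> xs ! 0 < xs ! 1 * Suc q)"
  proof (intro rec_Least rec_basic)
    fix xs :: "nat list"
    show "\<exists>q. xs ! 1 = 0 \<or> xs ! 0 < xs ! 1 * Suc q"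
      by (rule exI[of _ "xs ! 0"]) (cases "xs ! 1", auto)
  qed (auto simp: nth_append)
  then have "recursive_in h 2 (\<lambda>xs. xs ! 0 div xs ! 1)" by (simp only: *)
  then show ?thesis using assms by (rule rec_comp2)
qed

lemma rec_mod:
  assumes "recursive_in h n a" "recursive_in h n b"
  shows "recursive_in h n (\<lambda>xs. a xs mod b xs)"
  using rec_minus[OF assms(1) rec_times[OF assms(2) rec_div[OF assms]]]
  by (simp add: minus_mult_div_eq_mod)

lemma rec_prod_encode:
  assumes "recursive_in h n a" "recursive_in h n b"
  shows "recursive_in h n (\<lambda>xs. prod_encode (a xs, b xs))"
  unfolding prod_encode_def triangle_def prod.case
  using assms by (intro rec_basic rec_div)

lemma dec_mem_set_decode:
  assumes "recursive_in h n a" "recursive_in h n b"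
  shows "decidable_in h n (\<lambda>xs. a xs \<in> set_decode (b xs))"
proof -
  have "decidable_in h n (\<lambda>xs. (b xs div 2 ^ a xs) mod 2 = 1)"
    using assms by (intro rec_basic rec_div rec_mod)
  then show ?thesis by (simp add: set_decode_def odd_iff_mod_2_eq_one)
qed

lemma rec_prod_decode:
  assumes "recursive_in h n a"
  shows "recursive_in h n (\<lambda>xs. fst (prod_decode (a xs)))"
    and "recursive_in h n (\<lambda>xs. snd (prod_decode (a xs)))"
proof -
  have *: "(\<exists>y<Suc c. prod_encode (x, y) = c) \<longleftrightarrow> x = fst (prod_decode c)"
    "(\<exists>y<Suc c. prod_encode (y, x) = c) \<longleftrightarrow> x = snd (prod_decode c)" for x c
    by (metis prod_encode_inverse prod_decode_inverse fst_conv snd_conv prod.collapse less_Suc_eq_le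
        le_prod_encode_1 le_prod_encode_2)+
  have "recursive_in h 1 (\<lambda>xs. LEAST x. \<exists>y<Suc (xs ! 0). prod_encode (x, y) = xs ! 0)"
    by (intro rec_Least rec_basic rec_prod_encode) (auto simp: nth_append *)
  then have "recursive_in h 1 (\<lambda>xs. fst (prod_decode (xs ! 0)))"
    by (simp add: * Least_equality)
  then show "recursive_in h n (\<lambda>xs. fst (prod_decode (a xs)))"
    using assms by (rule rec_comp1)
  have "recursive_in h 1 (\<lambda>xs. LEAST x. \<exists>y<Suc (xs ! 0). prod_encode (y, x) = xs ! 0)"
    by (intro rec_Least rec_basic rec_prod_encode) (auto simp: nth_append *)
  then have "recursive_in h 1 (\<lambda>xs. snd (prod_decode (xs ! 0)))"
    by (simp add: * Least_equality)
  then show "recursive_in h n (\<lambda>xs. snd (prod_decode (a xs)))"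
    using assms by (rule rec_comp1)
qed

text \<open>The tail of a coded list is the second component of its predecessor; at the empty list, coded by
  \<open>0\<close>, this stays at \<open>0\<close> because \<open>prod_decode 0 = (0, 0)\<close>.\<close>
lemma list_encode_drop:
  "rec_nat (list_encode t) (\<lambda>k r. snd (prod_decode (r - 1))) i = list_encode (drop i t)"
proof (induction i)
  case (Suc i)
  have "prod_decode 0 = (0, 0)" using prod_encode_inverse[of "(0, 0)"] by (simp add: prod_encode_def)
  moreover have "drop (Suc i) t = tl (drop i t)" by (simp add: drop_Suc tl_drop)
  ultimately show ?case
    using Suc by (cases "drop i t") auto
qed simp

lemma rec_list_encode_drop:
  assumes "recursive_in h n a" "recursive_in h n b"
  shows "recursive_in h n (\<lambda>xs. list_encode (drop (b xs) (list_decode (a xs))))"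
proof -
  have "recursive_in h 2
      (\<lambda>xs. rec_nat (xs ! 0) (\<lambda>k r. snd (prod_decode (r - 1))) (xs ! 1))"
    by (intro rec_rec_nat rec_basic rec_prod_decode) auto
  then have "recursive_in h 2 (\<lambda>xs. list_encode (drop (xs ! 1) (list_decode (xs ! 0))))"
    by (simp flip: list_encode_drop)
  then show ?thesis using assms by (rule rec_comp2)
qed

lemma rec_length_list_decode:
  assumes "recursive_in h n a"
  shows "recursive_in h n (\<lambda>xs. length (list_decode (a xs)))"
proof -
  have *: "list_encode (drop i t) = 0 \<longleftrightarrow> length t \<le> i" for i t
    by (metis list_encode.simps(1) list_encode_inverse drop_eq_Nil)
  have "recursive_in h 1 (\<lambda>xs. LEAST i. list_encode (drop i (list_decode (xs ! 0))) = 0)"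
    by (intro rec_Least rec_basic rec_list_encode_drop) (auto simp: * nth_append)
  moreover have "(LEAST i. m \<le> i) = m" for m :: nat by (rule Least_equality) auto
  ultimately have "recursive_in h 1 (\<lambda>xs. length (list_decode (xs ! 0)))" by (simp only: *)
  then show ?thesis using assms by (rule rec_comp1)
qed

text \<open>The head of a remaining list, read off from its code; beyond the end of the list this is a
  definite value, as it must be for a recursive function.\<close>
definition nth_code :: "nat \<Rightarrow> nat \<Rightarrow> nat" where
  "nth_code c i = fst (prod_decode (list_encode (drop i (list_decode c)) - 1))"

lemma nth_code: "i < length t \<Longrightarrow> nth_code (list_encode t) i = t ! i"
  by (simp add: nth_code_def Cons_nth_drop_Suc[symmetric])

lemma rec_nth_code:
  assumes "recursive_in h n a" "recursive_in h n b"
  shows "recursive_in h n (\<lambda>xs. nth_code (a xs) (b xs))"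
  unfolding nth_code_def using assms by (intro rec_basic rec_prod_decode rec_list_encode_drop)

section \<open>Binary truncations\<close>

lemma set_decode_mod_pow2: "set_decode (v mod 2 ^ k) = set_decode v \<inter> {..<k}"
  unfolding set_decode_def by (auto simp: bit_iff_odd[symmetric] take_bit_eq_mod[symmetric] bit_take_bit_iff)

lemma set_encode_less_pow2: "A \<subseteq> {..<k} \<Longrightarrow> set_encode A < 2 ^ k"
proof -
  assume "A \<subseteq> {..<k}"
  then have "set_decode (set_encode A mod 2 ^ k) = A"
    by (subst set_decode_mod_pow2) (auto simp: finite_subset[OF _ finite_lessThan])
  then have "set_encode A mod 2 ^ k = set_encode A"
    by (metis set_decode_inverse)
  then show ?thesis
    by (metis mod_less_divisor zero_less_numeral zero_less_power)
qed

lemma set_encode_mod_pow2: "finite A \<Longrightarrow> set_encode A mod 2 ^ k = set_encode (A \<inter> {..<k})"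
  by (metis set_decode_inverse set_decode_mod_pow2 set_encode_inverse)

lemma less_set_encode: "finite A \<Longrightarrow> q \<in> A \<Longrightarrow> q < set_encode A"
proof -
  assume "finite A" "q \<in> A"
  then have "2 ^ q \<le> set_encode A" 
    unfolding set_encode_def by (auto intro: member_le_sum)
  then show ?thesis by (meson less_exp less_le_trans)
qed

text \<open>Numbers that are pairwise truncations of a common number cohere bit by bit, so they are all
  truncations of one set.\<close>
lemma glue_truncations:
  assumes "\<And>i j. i \<in> I \<Longrightarrow> j \<in> I \<Longrightarrow> \<exists>b. a i = b mod 2 ^ k i \<and> a j = b mod 2 ^ k j"
  shows "\<exists>Y. \<forall>i\<in>I. a i = set_encode (Y \<inter> {..<k i})"
proof (intro exI ballI)
  let ?Y = "\<Union>j\<in>I. set_decode (a j)"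
  fix i assume i: "i \<in> I"
  have "set_decode (a i) = ?Y \<inter> {..<k i}"
  proof (intro equalityI subsetI)
    fix q assume "q \<in> set_decode (a i)"
    then show "q \<in> ?Y \<inter> {..<k i}"
      using i assms[OF i i] by (auto simp: set_decode_mod_pow2)
  next
    fix q assume "q \<in> ?Y \<inter> {..<k i}"
    then obtain j where "j \<in> I" "q \<in> set_decode (a j)" "q < k i" by auto
    then show "q \<in> set_decode (a i)"
      using assms[OF i \<open>j \<in> I\<close>] by (auto simp: set_decode_mod_pow2)
  qed
  then show "a i = set_encode (?Y \<inter> {..<k i})" by (metis set_decode_inverse)
qed

lemma prod_encode_mono:
  assumes "a \<le> a'" "b \<le> b'"
  shows "prod_encode (a, b) \<le> prod_encode (a', b')"
proof -
  have "triangle m \<le> triangle n" if "m \<le> n" for m n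
    using that by (induction rule: dec_induct) auto
  then show ?thesis
    using assms by (auto simp: prod_encode_def intro: add_mono)
qed

section \<open>An almost disjoint family of sets of even numbers\<close>

text \<open>The topmost bit of a spot gives the length \<open>l\<close> of the initial segment of \<open>G\<close> that it encodes. The
  lowest bit is left free, which makes spots even.\<close>
definition spot :: "nat set \<Rightarrow> nat \<Rightarrow> nat" where
  "spot G l = set_encode (Suc ` insert l (G \<inter> {..<l}))"

lemma set_decode_spot: "set_decode (spot G l) = Suc ` insert l (G \<inter> {..<l})"
  unfolding spot_def by (rule set_encode_inverse) auto

lemma even_spot: "even (spot G l)"
  unfolding spot_def by (subst even_set_encode_iff) auto

lemma less_spot: "Suc l < spot G l"
  unfolding spot_def by (rule less_set_encode) auto

lemma spot_eqD:
  assumes "spot G l = spot G' l'"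
  shows "l = l'" "G \<inter> {..<l} = G' \<inter> {..<l}"
proof -
  have eq: "insert l (G \<inter> {..<l}) = insert l' (G' \<inter> {..<l'})"
    using arg_cong[OF assms, of set_decode] unfolding set_decode_spot
    by (simp only: inj_image_eq_iff[OF inj_Suc])
  have "Max (insert l (G \<inter> {..<l})) = l" for l :: nat and G by (rule Max_eqI) auto
  then show "l = l'" using eq by metis
  with eq show "G \<inter> {..<l} = G' \<inter> {..<l}" by auto
qed

lemma infinite_range_spot: "infinite (range (spot G))"
  by (rule range_inj_infinite) (auto intro!: injI dest: spot_eqD)

text \<open>A common spot encodes a common initial segment, so it cannot be longer than the first place where
  the two sets differ.\<close>
lemma finite_Int_range_spot:
  assumes "G \<noteq> G'" shows "finite (range (spot G) \<inter> range (spot G'))"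
proof -
  obtain p where p: "(p \<in> G) \<noteq> (p \<in> G')" using assms by auto
  have "range (spot G) \<inter> range (spot G') \<subseteq> spot G ` {..p}"
  proof
    fix n assume "n \<in> range (spot G) \<inter> range (spot G')"
    then obtain l l' where l: "n = spot G l" "n = spot G' l'" by blast
    have "G \<inter> {..<l} = G' \<inter> {..<l}" using l spot_eqD[of G l G' l'] by simp
    then have "l \<le> p" using p by (auto simp: set_eq_iff not_le[symmetric])
    with l show "n \<in> spot G ` {..p}" by auto
  qed
  then show ?thesis by (rule finite_subset) auto
qed

text \<open>The bounds on the quantifiers are what makes the set of spots decidable.\<close>
lemma range_spot_iff:
  "n \<in> range (spot G) \<longleftrightarrow> (\<exists>l<n. \<forall>q<Suc n. q \<in> set_decode n \<longleftrightarrow>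
    (\<exists>p<Suc l. q = Suc p \<and> (p = l \<or> p \<in> G)))"
proof
  assume "n \<in> range (spot G)"
  then obtain l where "n = spot G l" by auto
  then show "\<exists>l<n. \<forall>q<Suc n. q \<in> set_decode n \<longleftrightarrow>
    (\<exists>p<Suc l. q = Suc p \<and> (p = l \<or> p \<in> G))"
    using less_spot[of l G] by (intro exI[of _ l]) (auto simp: set_decode_spot)
next
  assume "\<exists>l<n. \<forall>q<Suc n. q \<in> set_decode n \<longleftrightarrow> (\<exists>p<Suc l. q = Suc p \<and> (p = l \<or> p \<in> G))"
  then obtain l where "l < n" and l: "\<And>q. q < Suc n \<Longrightarrow> q \<in> set_decode n \<longleftrightarrow>
    (\<exists>p<Suc l. q = Suc p \<and> (p = l \<or> p \<in> G))" by auto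
  have bound: "q < n" if "q \<in> set_decode n" for q
    using less_set_encode[of "set_decode n" q] that by simp
  have "q \<in> set_decode n \<longleftrightarrow> q \<in> Suc ` insert l (G \<inter> {..<l})" for q
    using l[of q] bound[of q] \<open>l < n\<close> by (cases "q < Suc n") (auto simp: image_iff simp del: set_decode_Suc)
  then have "set_decode n = Suc ` insert l (G \<inter> {..<l})" by blast
  then have "n = spot G l" unfolding spot_def by (metis set_decode_inverse)
  then show "n \<in> range (spot G)" by auto
qed

text \<open>A spot is larger than the length of the segment that it encodes.\<close>
lemma range_spot_cong:
  assumes "\<And>p. p < n \<Longrightarrow> p \<in> G \<longleftrightarrow> p \<in> G'"
  shows "n \<in> range (spot G) \<longleftrightarrow> n \<in> range (spot G')"
proof -
  have "n \<in> range (spot G')" if n: "n \<in> range (spot G)" and eq: "\<And>p. p < n \<Longrightarrow> p \<in> G \<longleftrightarrow> p \<in> G'" for G G'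
  proof -
    obtain l where l: "n = spot G l" using n by auto
    then have "G \<inter> {..<l} = G' \<inter> {..<l}" using eq less_spot[of l G] by auto
    then have "spot G l = spot G' l" by (simp add: spot_def)
    then show ?thesis using l by auto
  qed
  then show ?thesis using assms by metis
qed

section \<open>Infinite paths in finitely branching forests\<close>

text \<open>The forest on \<open>A\<close> is given by \<open>p\<close>, where \<open>p n = Suc m\<close> makes \<open>m\<close> the parent of \<open>n\<close> and \<open>p n = 0\<close> makes
  \<open>n\<close> a root. As in Koenig's lemma, the path is followed through nodes with infinitely many
  descendants; \<open>D s\<close> is the set of proper or improper descendants of the node named by \<open>s\<close>, where \<open>0\<close> names
  a root above all of \<open>A\<close>.\<close>
lemma konig_predecessors:
  fixes A :: "nat set" and p :: "nat \<Rightarrow> nat"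
  assumes inf: "infinite A"
    and p: "\<And>n. n \<in> A \<Longrightarrow> p n = 0 \<or> (\<exists>m\<in>A. m < n \<and> p n = Suc m)"
    and fin: "\<And>s. finite {n \<in> A. p n = s}"
  shows "\<exists>c. \<forall>i. c i \<in> A \<and> p (c (Suc i)) = Suc (c i)"
proof -
  define r where "r = {(p n, Suc n) |n. n \<in> A}"
  define D where "D s = {n \<in> A. (s, Suc n) \<in> r\<^sup>*}" for s
  have root: "(0, Suc n) \<in> r\<^sup>*" if "n \<in> A" for n
    using that
  proof (induction n rule: less_induct)
    case (less n)
    have step: "(p n, Suc n) \<in> r" using less.prems by (auto simp: r_def)
    show ?case
      using p[OF less.prems]
    proof
      assume "\<exists>m\<in>A. m < n \<and> p n = Suc m"
      then have "(0, p n) \<in> r\<^sup>*" using less.IH by auto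
      then show ?thesis using step by (rule rtrancl_into_rtrancl)
    qed (use step in auto)
  qed
  have split: "\<exists>n\<in>A. p n = s \<and> infinite (D (Suc n))" if "infinite (D s)" for s
  proof (rule ccontr)
    assume "\<not> ?thesis"
    then have "finite ((\<Union>n\<in>{n \<in> A. p n = s}. D (Suc n)) \<union> {n. Suc n = s})"
      using fin by (auto simp: finite_vimage_iff intro!: finite_subset[of "{n. Suc n = s}" "{..s}"])
    moreover have "D s \<subseteq> (\<Union>n\<in>{n \<in> A. p n = s}. D (Suc n)) \<union> {n. Suc n = s}"
    proof
      fix n assume "n \<in> D s"
      then have "n \<in> A" "(s, Suc n) \<in> r\<^sup>*" by (auto simp: D_def)
      from this(2) show "n \<in> (\<Union>n\<in>{n \<in> A. p n = s}. D (Suc n)) \<union> {n. Suc n = s}"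
        by (cases rule: converse_rtranclE) (use \<open>n \<in> A\<close> in \<open>auto simp: r_def D_def\<close>)
    qed
    ultimately show False using that finite_subset by blast
  qed
  have "D 0 = A" using root by (auto simp: D_def)
  then obtain n0 where n0: "n0 \<in> A" "infinite (D (Suc n0))" using split[of 0] inf by auto
  have "\<exists>c. \<forall>i. (c i \<in> A \<and> infinite (D (Suc (c i)))) \<and> p (c (Suc i)) = Suc (c i)"
    by (rule dependent_nat_choice[where P = "\<lambda>_ n. n \<in> A \<and> infinite (D (Suc n))"
          and Q = "\<lambda>_ m n. p n = Suc m"]) (use n0 split in blast)+
  then show ?thesis by blast
qed

section \<open>The family\<close>

definition graph_part :: "nat set \<Rightarrow> nat set" where
  "graph_part Y = {p. 2 * p + 1 \<in> Y}"

definition index_part :: "nat set \<Rightarrow> nat set" where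
  "index_part Y = {i. 2 * i \<in> Y}"

lemma infinite_odd: "infinite {n :: nat. odd n}"
  unfolding infinite_nat_iff_unbounded_le
proof
  fix m :: nat show "\<exists>n\<ge>m. n \<in> {n. odd n}" by (intro exI[of _ "2 * m + 1"]) auto
qed

text \<open>The truncation lengths \<open>k\<close> need not be monotone, since \<open>F\<close> need not compute any monotone function
  that tends to infinity and stays below it. This is why two lengths are compared in the relation on
  spots that follows.\<close>
locale ev_diff_coding =
  fixes F :: "nat \<Rightarrow> enat" and k :: "nat \<Rightarrow> nat"
  assumes k_le: "k n \<le> n"
    and pow_k_le: "enat (2 ^ k n) \<le> F n"
    and k_tendsto: "filterlim k at_top sequentially"
begin

lemma ex_large_k:
  assumes "infinite A" obtains n where "n \<in> A" "n \<ge> b" "k n \<ge> b"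
proof -
  have "\<forall>\<^sub>F n in sequentially. n \<ge> b \<and> k n \<ge> b"
    using k_tendsto by (auto simp: filterlim_at_top intro: eventually_conj eventually_ge_at_top)
  then obtain N where "\<And>n. n \<ge> N \<Longrightarrow> n \<ge> b \<and> k n \<ge> b" by (auto simp: eventually_sequentially)
  moreover obtain n where "n \<in> A" "n \<ge> N" using assms by (meson infinite_nat_iff_unbounded_le)
  ultimately show ?thesis using that by blast
qed

definition code :: "nat set \<Rightarrow> nat \<Rightarrow> nat" where
  "code Y n = set_encode (Y \<inter> {..<k n})"

text \<open>For the graph \<open>G\<close> of a function \<open>f\<close> and \<open>v = f n\<close>, the last conjunct says that \<open>f m\<close> is the
  truncation of \<open>f n\<close> to \<open>k m\<close> bits. It is phrased through \<open>v\<close> so that it can be decided from a bounded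
  part of \<open>G\<close>.\<close>
definition below :: "nat set \<Rightarrow> nat \<Rightarrow> nat \<Rightarrow> nat \<Rightarrow> bool" where
  "below G m n v \<longleftrightarrow> m \<in> range (spot G) \<and> m < n \<and> k m \<le> k n \<and> v < 2 ^ k n \<and>
    prod_encode (m, v mod 2 ^ k m) \<in> G"

text \<open>Here \<open>s = 0\<close> means that \<open>n\<close> is a root, and \<open>s = Suc m\<close> that \<open>m\<close> is the largest node below \<open>n\<close>.\<close>
definition parent :: "nat set \<Rightarrow> nat \<Rightarrow> nat \<Rightarrow> nat \<Rightarrow> bool" where
  "parent G n v s \<longleftrightarrow> (s = 0 \<or> below G (s - 1) n v) \<and> (\<forall>m<n. s \<le> m \<longrightarrow> \<not> below G m n v)"

text \<open>\<open>Y\<close> prescribes the value \<open>v\<close> at \<open>n\<close>. Since \<open>Y\<close> is arbitrary, its graph part may contain several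
  pairs \<open>(n, v)\<close>, of which the least \<open>v\<close> counts, and its index part is only required to look like the
  singleton \<open>{s}\<close> up to \<open>n\<close>. As a parent is at most \<open>n\<close>, this is enough to determine \<open>s\<close>, and it keeps
  the condition decidable; if the index part has several elements, \<open>Y\<close> prescribes only finitely many
  values.\<close>
definition override :: "nat set \<Rightarrow> nat \<Rightarrow> nat \<Rightarrow> bool" where
  "override Y n v \<longleftrightarrow> n \<in> range (spot (graph_part Y)) \<and> enat v < F n \<and>
    (\<forall>w<Suc v. prod_encode (n, w) \<in> graph_part Y \<longleftrightarrow> w = v) \<and>
    (\<exists>s<Suc n. (\<forall>i<Suc n. i \<in> index_part Y \<longleftrightarrow> i = s) \<and> parent (graph_part Y) n v s)"

definition member :: "nat set \<Rightarrow> nat \<Rightarrow> nat" where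
  "member Y n = (if \<exists>v. override Y n v then THE v. override Y n v else code Y n)"

lemma code_less: "code Y n < 2 ^ k n"
  unfolding code_def by (rule set_encode_less_pow2) auto

lemma set_decode_code: "set_decode (code Y n) = Y \<inter> {..<k n}"
  unfolding code_def by (rule set_encode_inverse) auto

lemma code_mod: "k m \<le> k n \<Longrightarrow> code Y n mod 2 ^ k m = code Y m"
  unfolding code_def by (subst set_encode_mod_pow2) (auto intro!: arg_cong[where f = set_encode])

lemma finite_code_eq:
  assumes "Y \<noteq> Z" shows "finite {n. code Y n = code Z n}"
proof (rule ccontr)
  obtain q where q: "(q \<in> Y) \<noteq> (q \<in> Z)" using assms by auto
  assume "infinite {n. code Y n = code Z n}"
  then obtain n where "code Y n = code Z n" "k n \<ge> Suc q" using ex_large_k by blast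
  then have "Y \<inter> {..<k n} = Z \<inter> {..<k n}" by (metis set_decode_code)
  moreover have "q \<in> {..<k n}" using \<open>k n \<ge> Suc q\<close> by simp
  ultimately show False using q by blast
qed

lemma override_unique: "override Y n v \<Longrightarrow> override Y n w \<Longrightarrow> v = w"
  unfolding override_def by (metis lessI less_Suc_eq_le nat_le_linear)

lemma member_override: "override Y n v \<Longrightarrow> member Y n = v"
  unfolding member_def using override_unique by (auto intro!: the_equality)

lemma member_code: "(\<And>v. \<not> override Y n v) \<Longrightarrow> member Y n = code Y n"
  unfolding member_def by auto

lemma member_odd: "odd n \<Longrightarrow> member Y n = code Y n"
  by (rule member_code) (auto simp: override_def even_spot)

lemma member_in_NF: "member Y \<in> NF F"
proof -
  have "enat (member Y n) < F n" for n
  proof (cases "\<exists>v. override Y n v")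
    case True
    then show ?thesis using member_override by (auto simp: override_def)
  next
    case False
    then show ?thesis
      using code_less[of Y n] pow_k_le[of n] by (simp add: member_code less_le_trans[of _ "enat (2 ^ k n)"])
  qed
  then show ?thesis by (simp add: NF_def)
qed

lemma parent_exists: "\<exists>s. parent G n v s"
proof (cases "\<exists>m. below G m n v")
  case True
  let ?m = "Max {m. below G m n v}"
  have fin: "finite {m. below G m n v}"
    by (rule finite_subset[of _ "{..<n}"]) (auto simp: below_def)
  have "below G ?m n v" using Max_in[OF fin] True by auto
  moreover have "m \<le> ?m" if "below G m n v" for m using Max_ge[OF fin] that by auto
  ultimately have "parent G n v (Suc ?m)" by (auto simp: parent_def Suc_le_eq leD)
  then show ?thesis ..
next
  case False
  then have "parent G n v 0" by (auto simp: parent_def)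
  then show ?thesis ..
qed

lemma parent_unique:
  assumes "parent G n v s" "parent G n v t" shows "s = t"
proof -
  have "\<not> s < t" if "parent G n v s" "parent G n v t" for s t
  proof
    assume "s < t"
    then have "below G (t - 1) n v" "s \<le> t - 1" using that by (auto simp: parent_def)
    then show False using that by (auto simp: parent_def below_def)
  qed
  then show ?thesis using assms by (meson linorder_neqE_nat)
qed

text \<open>Suppose \<open>Y\<close> prescribes the value of \<open>code Z\<close> infinitely often. Its index part has an element \<open>s\<close>,
  so \<open>s\<close> names the parent at all large places of this kind. Choose such places \<open>m \<ge> s\<close> and \<open>n > m\<close>
  with \<open>k n \<ge> k m\<close>. Then \<open>code Z m\<close> is a truncation of \<open>code Z n\<close>, so \<open>m\<close> is below \<open>n\<close>, and the parent
  of \<open>n\<close> would be named by a number larger than \<open>m\<close>.\<close>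
lemma finite_override_code: "finite {n. override Y n (code Z n)}"
proof (rule ccontr)
  let ?A = "{n. override Y n (code Z n)}"
  assume inf: "infinite ?A"
  obtain n0 where n0: "override Y n0 (code Z n0)" using ex_large_k[OF inf, of 0] by blast
  then obtain s where "s < Suc n0" "\<forall>i<Suc n0. i \<in> index_part Y \<longleftrightarrow> i = s"
    unfolding override_def by blast
  then have s: "s \<in> index_part Y" by blast
  obtain m where m: "m \<in> ?A" "m \<ge> s" by (rule ex_large_k[OF inf])
  obtain n where n: "n \<in> ?A" "n \<ge> Suc m" "k n \<ge> Suc m" by (rule ex_large_k[OF inf])
  then obtain t where t: "\<forall>i<Suc n. i \<in> index_part Y \<longleftrightarrow> i = t"
    and par: "parent (graph_part Y) n (code Z n) t" by (auto simp: override_def)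
  have "t = s" using t s m n by auto
  have "k m \<le> k n" using k_le[of m] n by linarith
  then have "below (graph_part Y) m n (code Z n)"
    using m n code_less[of Z n] by (auto simp: below_def code_mod override_def)
  with par \<open>t = s\<close> m n show False by (auto simp: parent_def)
qed

text \<open>Infinitely many common spots force equal graph parts. With the same graph part, a place and the
  value there determine the parent, which determines the index parts up to that place.\<close>
lemma finite_override_common:
  assumes "Y \<noteq> Z" shows "finite {n. \<exists>v. override Y n v \<and> override Z n v}" (is "finite ?A")
proof (rule ccontr)
  assume inf: "infinite ?A"
  have "?A \<subseteq> range (spot (graph_part Y)) \<inter> range (spot (graph_part Z))"
    by (auto simp: override_def)
  then have G: "graph_part Y = graph_part Z"
    using inf finite_Int_range_spot finite_subset by metis
  have "\<not> (q \<in> Y \<and> q \<notin> Z) \<and> \<not> (q \<notin> Y \<and> q \<in> Z)" for q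
  proof (cases "even q")
    case True
    then obtain i where i: "q = 2 * i" by auto
    obtain n where n: "n \<in> ?A" "n \<ge> i" by (rule ex_large_k[OF inf])
    then obtain v where v: "override Y n v" "override Z n v" by auto
    obtain s where s: "\<forall>i<Suc n. i \<in> index_part Y \<longleftrightarrow> i = s" "parent (graph_part Y) n v s"
      using v(1) unfolding override_def by (elim conjE exE)
    obtain t where t: "\<forall>i<Suc n. i \<in> index_part Z \<longleftrightarrow> i = t" "parent (graph_part Z) n v t"
      using v(2) unfolding override_def by (elim conjE exE)
    have "s = t" using s(2) t(2) unfolding G by (rule parent_unique)
    then have "i \<in> index_part Y \<longleftrightarrow> i \<in> index_part Z" using s(1) t(1) n(2) by simp
    then show ?thesis using i by (simp add: index_part_def)
  next
    case False
    then obtain i where "q = 2 * i + 1" by (auto elim: oddE)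
    then show ?thesis using G by (auto simp: graph_part_def set_eq_iff)
  qed
  then show False using assms by auto
qed

lemma member_ev_different:
  assumes "Y \<noteq> Z" shows "eventually_different (member Y) (member Z)"
proof -
  have "{n. member Y n = member Z n} \<subseteq> {n. code Y n = code Z n} \<union> {n. override Y n (code Z n)}
    \<union> {n. override Z n (code Y n)} \<union> {n. \<exists>v. override Y n v \<and> override Z n v}"
    using member_override member_code by (smt (verit, ccfv_threshold) UnCI mem_Collect_eq subsetI)
  then show ?thesis
    unfolding eventually_different_def
    using finite_code_eq[OF assms] finite_override_common[OF assms]
      finite_override_code[of Y Z] finite_override_code[of Z Y]
    by (meson finite_UnI finite_subset)
qed

section \<open>Maximality\<close>

text \<open>The two cases are those of Koenig's lemma for the forest on the spots of the graph \<open>G\<close> of \<open>f\<close>: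
  a node with infinitely many children is used as the index of a set with graph part \<open>G\<close>, and an
  infinite path yields a set whose code agrees with \<open>f\<close>.\<close>
lemma infinite_agreement:
  assumes f: "f \<in> NF F" shows "\<exists>Y. infinite {n. member Y n = f n}"
proof -
  define G where "G = range (\<lambda>n. prod_encode (n, f n))"
  have G_iff: "prod_encode (n, v) \<in> G \<longleftrightarrow> v = f n" for n v by (auto simp: G_def)
  have override_if: "override Y n (f n)" if "graph_part Y = G" "n \<in> range (spot G)"
    "\<forall>i<Suc n. i \<in> index_part Y \<longleftrightarrow> i = s" "s < Suc n" "parent G n (f n) s" for Y n s
    unfolding override_def using that f by (auto simp: NF_def G_iff)
  define p where "p n = (SOME s. parent G n (f n) s)" for n
  have p: "parent G n (f n) (p n)" for n
    unfolding p_def using parent_exists by (rule someI_ex)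
  have p_cases: "p n = 0 \<or> below G (p n - 1) n (f n)" for n
    using p[of n] by (auto simp: parent_def)
  show ?thesis
  proof (cases "\<exists>s. infinite {n \<in> range (spot G). p n = s}")
    case True
    then obtain s where s: "infinite {n \<in> range (spot G). p n = s}" ..
    define Y where "Y = insert (2 * s) ((\<lambda>p. 2 * p + 1) ` G)"
    have Y: "graph_part Y = G" "i \<in> index_part Y \<longleftrightarrow> i = s" for i
      by (auto simp: Y_def graph_part_def index_part_def elim: oddE dest: arg_cong[of _ _ even])
    have "{n \<in> range (spot G). p n = s} \<subseteq> {n. member Y n = f n}"
    proof
      fix n assume n: "n \<in> {n \<in> range (spot G). p n = s}"
      then have "s < Suc n" "parent G n (f n) s"
        using p_cases[of n] p[of n] by (auto simp: below_def)
      then have "override Y n (f n)" using Y n by (intro override_if) auto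
      then show "n \<in> {n. member Y n = f n}" by (simp add: member_override)
    qed
    then show ?thesis using s finite_subset by blast
  next
    case False
    have "\<exists>c. \<forall>i. c i \<in> range (spot G) \<and> p (c (Suc i)) = Suc (c i)"
    proof (rule konig_predecessors)
      fix n show "p n = 0 \<or> (\<exists>m\<in>range (spot G). m < n \<and> p n = Suc m)"
        using p_cases[of n] by (cases "p n") (auto simp: below_def)
    qed (use False infinite_range_spot in auto)
    then obtain c where c: "\<And>i. c i \<in> range (spot G)" and "\<And>i. p (c (Suc i)) = Suc (c i)" by blast
    then have step: "below G (c i) (c (Suc i)) (f (c (Suc i)))" for i
      using p_cases[of "c (Suc i)"] by simp
    have k_mono: "k (c i) \<le> k (c j)" if "i \<le> j" for i j
    proof (rule lift_Suc_mono_le[of "\<lambda>i. k (c i)", OF _ that])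
      fix i show "k (c i) \<le> k (c (Suc i))" using step[of i] unfolding below_def by blast
    qed
    have c_mono: "strict_mono c"
      unfolding strict_mono_Suc_iff using step unfolding below_def by blast
    have f_step: "f (c i) = f (c (Suc i)) mod 2 ^ k (c i)" for i
      using step[of i] unfolding below_def G_iff by simp
    have f_mod: "f (c i) = f (c j) mod 2 ^ k (c i)" if "i \<le> j" for i j
      using that
    proof (induction j rule: dec_induct)
      case base
      show ?case by (subst (1 2) f_step) simp
    next
      case (step j)
      then show ?case
        using f_step[of j] mod_mod_cancel[OF le_imp_power_dvd[OF k_mono[OF step.hyps(1)]], of "f (c (Suc j))" 2]
        by simp
    qed
    \<comment> \<open>Along the path each value of \<open>f\<close> is a truncation of all later ones.\<close>
    have "\<exists>Y. \<forall>i\<in>UNIV. f (c i) = set_encode (Y \<inter> {..<k (c i)})"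
    proof (rule glue_truncations)
      fix i j
      show "\<exists>b. f (c i) = b mod 2 ^ k (c i) \<and> f (c j) = b mod 2 ^ k (c j)"
        using f_mod[of i "max i j"] f_mod[of j "max i j"] by auto
    qed
    then obtain Y where Y: "\<And>i. f (c i) = code Y (c i)" by (auto simp: code_def)
    let ?X = "range c - range (spot (graph_part Y))"
    have inf: "infinite (range c)" using c_mono by (intro range_inj_infinite strict_mono_imp_inj_on)
    show ?thesis
    \<comment> \<open>The codes of \<open>Y\<close> agree with \<open>f\<close> on the path, but \<open>member Y\<close> may differ from \<open>code Y\<close> there.\<close>
    proof (cases "graph_part Y = G")
      case True
      have "member Y (c i) = f (c i)" for i
      proof (cases "\<exists>v. override Y (c i) v")
        case True
        then obtain v where v: "override Y (c i) v" ..
        then have "prod_encode (c i, v) \<in> G"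
          using \<open>graph_part Y = G\<close> by (auto simp: override_def)
        then show ?thesis using v by (simp add: G_iff member_override)
      qed (simp add: Y member_code)
      then have "range c \<subseteq> {n. member Y n = f n}" by auto
      then show ?thesis using inf finite_subset by blast
    next
      case False
      have "member Y (c i) = f (c i)" if "c i \<notin> range (spot (graph_part Y))" for i
        unfolding Y using that by (intro member_code) (auto simp: override_def)
      then have "?X \<subseteq> {n. member Y n = f n}" by auto
      moreover have "range c \<inter> range (spot (graph_part Y)) \<subseteq> range (spot G) \<inter> range (spot (graph_part Y))"
        using c by auto
      then have "finite (range c \<inter> range (spot (graph_part Y)))"
        using finite_Int_range_spot[of G "graph_part Y"] False finite_subset by metis
      then have "infinite ?X"
        using inf by (metis Int_Diff_Un finite_Un)
      ultimately show ?thesis using finite_subset by blast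
    qed
  qed
qed

lemma maximal_range_member: "maximal_ev_diff_family F (range member)"
  unfolding maximal_ev_diff_family_def
proof (intro conjI allI impI)
  show fam: "ev_diff_family F (range member)"
    unfolding ev_diff_family_def
  proof (intro conjI pairwiseI)
    show "range member \<subseteq> NF F" using member_in_NF by (rule image_subsetI)
    fix f g assume "f \<in> range member" "g \<in> range member" "f \<noteq> g"
    then obtain Y Z where "f = member Y" "g = member Z" "Y \<noteq> Z" by blast
    then show "eventually_different f g" using member_ev_different by simp
  qed
  fix E assume E: "ev_diff_family F E \<and> range member \<subseteq> E"
  show "E = range member"
  proof (rule antisym)
    show "E \<subseteq> range member"
    proof
      fix f assume f: "f \<in> E"
      then obtain Y where "infinite {n. member Y n = f n}"
        using infinite_agreement E unfolding ev_diff_family_def by blast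
      then have "\<not> eventually_different (member Y) f" by (simp add: eventually_different_def)
      moreover have "member Y \<in> E" using E by blast
      ultimately have "member Y = f"
        using E f unfolding ev_diff_family_def pairwise_def by metis
      then show "f \<in> range member" by (rule range_eqI[OF sym])
    qed
  qed (use E in simp)
qed

end

section \<open>Closed and perfect subsets of the space\<close>

lemma openin_NF_cylinder:
  "openin (NF_topology F) {g \<in> NF F. \<forall>i<n. g i = x i}"
proof -
  let ?U = "\<lambda>i. {k. enat k < F i \<and> (i < n \<longrightarrow> k = x i)}"
  have "finite {i. ?U i \<noteq> topspace (discrete_topology {k. enat k < F i})}"
    by (rule finite_subset[of _ "{..<n}"]) auto
  then have "openin (NF_topology F) (PiE UNIV ?U)"
    unfolding NF_topology_def by (intro product_topology_basis) auto
  moreover have "PiE UNIV ?U = {g \<in> NF F. \<forall>i<n. g i = x i}"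
    by (auto simp: NF_def PiE_def Pi_def)
  ultimately show ?thesis by simp
qed

lemma closedin_branches:
  assumes "branches T \<subseteq> NF F" shows "closedin (NF_topology F) (branches T)"
  unfolding closedin_def topspace_NF_topology
proof (intro conjI assms)
  show "openin (NF_topology F) (NF F - branches T)"
  proof (subst openin_subopen, intro ballI)
    fix x assume x: "x \<in> NF F - branches T"
    then obtain n where n: "map x [0..<n] \<notin> T" by (auto simp: branches_def)
    have "g \<notin> branches T" if "\<forall>i<n. g i = x i" for g
    proof -
      have "map g [0..<n] = map x [0..<n]" using that by simp
      then show ?thesis using n unfolding branches_def by (metis mem_Collect_eq)
    qed
    then show "\<exists>U. openin (NF_topology F) U \<and> x \<in> U \<and> U \<subseteq> NF F - branches T"
      using x by (intro exI[of _ "{g \<in> NF F. \<forall>i<n. g i = x i}"]) (auto simp: openin_NF_cylinder)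
  qed
qed

lemma perfect_in_NF_topologyI:
  assumes "S \<noteq> {}" and closed: "closedin (NF_topology F) S"
    and near: "\<And>x N. x \<in> S \<Longrightarrow> \<exists>y\<in>S. y \<noteq> x \<and> (\<forall>i<N. y i = x i)"
  shows "perfect_in (NF_topology F) S"
  unfolding perfect_in_def
proof (intro conjI assms ballI notI)
  fix x assume x: "x \<in> S" and "openin (subtopology (NF_topology F) S) {x}"
  then obtain V where V: "openin (NF_topology F) V" "V \<inter> S = {x}"
    unfolding openin_subtopology by metis
  then have "x \<in> V" by blast
  then obtain U where U: "finite {i. U i \<noteq> {k. enat k < F i}}" "x \<in> PiE UNIV U" "PiE UNIV U \<subseteq> V"
    using V(1) unfolding NF_topology_def openin_product_topology_alt by auto
  then obtain N where N: "\<And>i. U i \<noteq> {k. enat k < F i} \<Longrightarrow> i < N"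
    using finite_nat_set_iff_bounded[of "{i. U i \<noteq> {k. enat k < F i}}"] by blast
  obtain y where y: "y \<in> S" "y \<noteq> x" "\<forall>i<N. y i = x i" using near[OF x] by blast
  have "y \<in> NF F" using closedin_subset[OF closed] y(1) by (auto simp: topspace_NF_topology)
  then have "y i \<in> U i" for i
    using U(2) y(3) N[of i] by (cases "i < N") (auto simp: NF_def PiE_def Pi_def)
  then have "y \<in> V" using U(3) by (auto simp: PiE_def)
  then show False using V(2) y by auto
qed

section \<open>The tree of the family\<close>

context ev_diff_coding
begin

text \<open>The largest element of \<open>Y\<close> that matters is the one that represents the pair \<open>(n, v)\<close>: the codes of
  pairs are monotone and bound the spots and indices up to \<open>n\<close>.\<close>
lemma override_cong:
  assumes eq: "Y \<inter> {..<b} = Z \<inter> {..<b}" and b: "2 * prod_encode (n, v) + 2 \<le> b"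
  shows "override Y n v \<longleftrightarrow> override Z n v"
proof -
  let ?p = "prod_encode (n, v)"
  have mem: "q \<in> Y \<longleftrightarrow> q \<in> Z" if "q < 2 * ?p + 2" for q
  proof -
    have "q \<in> {..<b}" using that b by simp
    then show ?thesis using eq by blast
  qed
  have G: "q \<in> graph_part Y \<longleftrightarrow> q \<in> graph_part Z" if "q \<le> ?p" for q
    unfolding graph_part_def using mem[of "2 * q + 1"] that by simp
  have I: "i \<in> index_part Y \<longleftrightarrow> i \<in> index_part Z" if "i < Suc n" for i
    unfolding index_part_def using mem[of "2 * i"] that le_prod_encode_1[of n v] by simp
  have spots: "m \<in> range (spot (graph_part Y)) \<longleftrightarrow> m \<in> range (spot (graph_part Z))" if "m \<le> n" for m
    using that le_prod_encode_1[of n v] by (intro range_spot_cong G) simp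
  have below: "below (graph_part Y) m n v \<longleftrightarrow> below (graph_part Z) m n v" for m
  proof (cases "m < n")
    case True
    have "prod_encode (m, v mod 2 ^ k m) \<le> ?p"
      using True by (intro prod_encode_mono) auto
    then show ?thesis unfolding below_def using G spots True by simp
  qed (simp add: below_def)
  have "parent (graph_part Y) n v s \<longleftrightarrow> parent (graph_part Z) n v s" for s
    unfolding parent_def below ..
  moreover have "prod_encode (n, w) \<in> graph_part Y \<longleftrightarrow> prod_encode (n, w) \<in> graph_part Z"
    if "w < Suc v" for w
    using that by (intro G prod_encode_mono) auto
  ultimately show ?thesis
    unfolding override_def using spots[of n] I by (simp cong: conj_cong)
qed

text \<open>Toggling the index \<open>N\<close> in \<open>Y\<close> does not affect the changes or the codes below \<open>N\<close>, since
  \<open>override Y n\<close> only looks at indices up to \<open>n\<close>, and \<open>k n \<le> n\<close>.\<close>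
lemma ex_member_agreeing:
  "\<exists>Z. member Z \<noteq> member Y \<and> (\<forall>n<N. member Z n = member Y n)"
proof (intro exI conjI allI impI)
  let ?Z = "if 2 * N \<in> Y then Y - {2 * N} else insert (2 * N) Y"
  have Z: "q \<in> ?Z \<longleftrightarrow> (if q = 2 * N then q \<notin> Y else q \<in> Y)" for q by auto
  have "?Z \<noteq> Y" by auto
  show "member ?Z \<noteq> member Y"
  proof
    assume "member ?Z = member Y"
    moreover have "finite {n. member ?Z n = member Y n}"
      using member_ev_different[OF \<open>?Z \<noteq> Y\<close>] by (simp add: eventually_different_def)
    ultimately show False by simp
  qed
  fix n assume "n < N"
  have G: "graph_part ?Z = graph_part Y"
    unfolding graph_part_def Z by (auto dest: arg_cong[of _ _ even])
  have I: "i \<in> index_part ?Z \<longleftrightarrow> i \<in> index_part Y" if "i < Suc n" for i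
    unfolding index_part_def mem_Collect_eq Z using that \<open>n < N\<close> by simp
  have "override ?Z n = override Y n"
    unfolding override_def[abs_def] G using I by simp
  moreover have "?Z \<inter> {..<k n} = Y \<inter> {..<k n}"
    using k_le[of n] \<open>n < N\<close> by auto
  then have "code ?Z n = code Y n" by (simp only: code_def)
  ultimately show "member ?Z n = member Y n" unfolding member_def by (simp only:)
qed

text \<open>Given \<open>a = h n\<close> and \<open>b = h N\<close> for a function \<open>h\<close> and an odd \<open>N\<close>, so that \<open>b\<close> should be the truncation to
  \<open>k N\<close> bits of the set that defines \<open>h\<close>: does \<open>h n\<close> obey this set? The premises ensure that \<open>k N\<close> bits are
  sufficient to answer the question.\<close>
definition consistent :: "nat \<Rightarrow> nat \<Rightarrow> nat \<Rightarrow> nat \<Rightarrow> nat \<Rightarrow> bool" where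
  "consistent n N v a b \<longleftrightarrow>
    (2 * prod_encode (n, v) + 2 \<le> k N \<and> override (set_decode b) n v \<longrightarrow> a = v) \<and>
    (2 * prod_encode (n, a) + 2 \<le> k N \<and> k n \<le> k N \<longrightarrow>
      override (set_decode b) n a \<or> a = b mod 2 ^ k n)"

definition tree :: "nat list set" where
  "tree = {t. \<forall>n<length t. \<forall>N<length t. odd N \<longrightarrow>
    (\<forall>v<length t. consistent n N v (t ! n) (t ! N))}"

lemma seq_tree_tree: "seq_tree tree"
  unfolding seq_tree_def
proof (intro ballI allI impI)
  fix s t assume t: "t \<in> tree" and "prefix s t"
  then obtain r where "t = s @ r" by (auto elim: prefixE)
  then have len: "length s \<le> length t" and nth: "i < length s \<Longrightarrow> s ! i = t ! i" for i
    by (auto simp: nth_append)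
  show "s \<in> tree"
    unfolding tree_def
  proof (intro CollectI allI impI)
    fix n N v assume "n < length s" "N < length s" "odd N" "v < length s"
    then show "consistent n N v (s ! n) (s ! N)"
      using t len unfolding tree_def by (simp add: nth)
  qed
qed

lemma branches_tree_iff:
  "h \<in> branches tree \<longleftrightarrow> (\<forall>n N v. odd N \<longrightarrow> consistent n N v (h n) (h N))"
proof
  assume h: "h \<in> branches tree"
  show "\<forall>n N v. odd N \<longrightarrow> consistent n N v (h n) (h N)"
  proof (intro allI impI)
    fix n N v :: nat assume "odd N"
    let ?t = "map h [0..<Suc (n + N + v)]"
    have "?t \<in> tree" using h unfolding branches_def by blast
    then have "consistent n N v (?t ! n) (?t ! N)"
      using \<open>odd N\<close> unfolding tree_def by (simp del: upt_Suc)
    then show "consistent n N v (h n) (h N)" by (simp del: upt_Suc)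
  qed
qed (simp add: branches_def tree_def)

lemma override_code:
  "2 * prod_encode (n, v) + 2 \<le> k N \<Longrightarrow> override (set_decode (code Y N)) n v \<longleftrightarrow> override Y n v"
  by (rule override_cong[of _ "k N"]) (auto simp: set_decode_code)

text \<open>For a branch \<open>h\<close> and odd \<open>n\<close> there are no changes at \<open>n\<close>, so \<open>h n\<close> is a truncation of \<open>h N\<close> for all
  odd \<open>N\<close> with \<open>k N\<close> large. Hence the odd values glue to a set \<open>Y\<close>. As \<open>k N\<close> is unbounded on odd \<open>N\<close>,
  every instance of the conditions that define \<open>member Y\<close> is eventually tested.\<close>
lemma branches_tree: "branches tree = range member"
proof (intro equalityI subsetI)
  fix h assume "h \<in> range member"
  then obtain Y where h: "h = member Y" by auto
  show "h \<in> branches tree"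
    unfolding branches_tree_iff
  proof (intro allI impI)
    fix n N v :: nat assume "odd N"
    show "consistent n N v (h n) (h N)"
      unfolding consistent_def h member_odd[OF \<open>odd N\<close>]
    proof (intro conjI impI; elim conjE)
      assume "2 * prod_encode (n, v) + 2 \<le> k N" "override (set_decode (code Y N)) n v"
      then show "member Y n = v" using override_code member_override by simp
    next
      assume le: "2 * prod_encode (n, member Y n) + 2 \<le> k N" "k n \<le> k N"
      show "override (set_decode (code Y N)) n (member Y n) \<or> member Y n = code Y N mod 2 ^ k n"
      proof (cases "\<exists>w. override Y n w")
        case True
        then have "override Y n (member Y n)" using member_override by metis
        then show ?thesis using override_code[OF le(1)] by simp
      next
        case False
        then show ?thesis using code_mod[OF le(2)] member_code by simp
      qed
    qed
  qed
next
  fix h assume "h \<in> branches tree"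
  then have h: "consistent n N v (h n) (h N)" if "odd N" for n N v
    using that unfolding branches_tree_iff by blast
  have odd_eq: "h n = h N mod 2 ^ k n"
    if "odd n" "odd N" "2 * prod_encode (n, h n) + 2 + k n \<le> k N" for n N
  proof -
    have "\<not> override Z n w" for Z w using \<open>odd n\<close> even_spot by (auto simp: override_def)
    then show ?thesis using h[OF that(2), of n] that(3) unfolding consistent_def by simp
  qed
  have large: "\<exists>N. odd N \<and> b \<le> k N" for b
    using ex_large_k[OF infinite_odd, of b] by blast
  have "\<exists>Y. \<forall>i\<in>{n. odd n}. h i = set_encode (Y \<inter> {..<k i})"
  proof (rule glue_truncations)
    fix i j :: nat assume "i \<in> {n. odd n}" "j \<in> {n. odd n}"
    moreover obtain N where "odd N"
      "(2 * prod_encode (i, h i) + 2 + k i) + (2 * prod_encode (j, h j) + 2 + k j) \<le> k N"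
      using large by blast
    ultimately have "h i = h N mod 2 ^ k i \<and> h j = h N mod 2 ^ k j"
      using odd_eq[of i N] odd_eq[of j N] by simp
    then show "\<exists>b. h i = b mod 2 ^ k i \<and> h j = b mod 2 ^ k j" ..
  qed
  then obtain Y where Y: "\<And>i. odd i \<Longrightarrow> h i = code Y i" by (auto simp: code_def)
  have "h n = member Y n" for n
  proof (cases "\<exists>v. override Y n v")
    case True
    then obtain v where v: "override Y n v" ..
    obtain N where N: "odd N" "2 * prod_encode (n, v) + 2 \<le> k N" using large by blast
    then have "h n = v"
      using h[OF N(1), of n v] v override_code[OF N(2), of Y] Y[OF N(1)] unfolding consistent_def by simp
    then show ?thesis using member_override[OF v] by simp
  next
    case False
    obtain N where N: "odd N" "2 * prod_encode (n, h n) + 2 + k n \<le> k N" using large by blast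
    then have "h n = h N mod 2 ^ k n"
      using h[OF N(1), of n] False override_code[of n "h n" N Y] Y[OF N(1)] unfolding consistent_def by simp
    then show ?thesis using False N(2) Y[OF N(1)] by (simp add: code_mod member_code)
  qed
  then show "h \<in> range member" by (intro range_eqI[of _ _ Y]) auto
qed

lemma perfect_range_member: "perfect_in (NF_topology F) (range member)"
proof (rule perfect_in_NF_topologyI)
  have "branches tree \<subseteq> NF F" unfolding branches_tree using member_in_NF by (rule image_subsetI)
  then show "closedin (NF_topology F) (range member)"
    using closedin_branches branches_tree by metis
  fix x N assume "x \<in> range member"
  then obtain Y where "x = member Y" by auto
  then show "\<exists>y\<in>range member. y \<noteq> x \<and> (\<forall>i<N. y i = x i)"
    using ex_member_agreeing[of Y N] by blast
qed simp

end

section \<open>Decidability of the tree\<close>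

lemma dec_odd: "recursive_in h n a \<Longrightarrow> decidable_in h n (\<lambda>xs. odd (a xs))"
  unfolding odd_iff_mod_2_eq_one by (intro rec_basic rec_mod)

lemma dec_mem_graph_part:
  assumes "recursive_in h n a" "recursive_in h n b"
  shows "decidable_in h n (\<lambda>xs. a xs \<in> graph_part (set_decode (b xs)))"
  unfolding graph_part_def mem_Collect_eq using assms by (intro rec_basic dec_mem_set_decode)

lemma dec_mem_index_part:
  assumes "recursive_in h n a" "recursive_in h n b"
  shows "decidable_in h n (\<lambda>xs. a xs \<in> index_part (set_decode (b xs)))"
  unfolding index_part_def mem_Collect_eq using assms by (intro rec_basic dec_mem_set_decode)

lemma dec_mem_range_spot:
  assumes "recursive_in h n a" "recursive_in h n b"
  shows "decidable_in h n (\<lambda>xs. a xs \<in> range (spot (graph_part (set_decode (b xs)))))"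
proof -
  have "decidable_in h 2 (\<lambda>xs. xs ! 0 \<in> range (spot (graph_part (set_decode (xs ! 1)))))"
    unfolding range_spot_iff
    by (intro rec_basic dec_mem_set_decode dec_mem_graph_part) (auto simp: nth_append)
  then show ?thesis using assms by (rule dec_comp2)
qed

locale recursive_coding = ev_diff_coding +
  fixes h :: "nat \<Rightarrow> nat"
  assumes rec_k: "recursive_in h 1 (\<lambda>xs. k (xs ! 0))"
    and dec_less_F: "decidable_in h 2 (\<lambda>xs. enat (xs ! 0) < F (xs ! 1))"
begin

lemma dec_below:
  assumes "recursive_in h r b" "recursive_in h r m" "recursive_in h r n" "recursive_in h r v"
  shows "decidable_in h r (\<lambda>xs. below (graph_part (set_decode (b xs))) (m xs) (n xs) (v xs))"
  unfolding below_def using assms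
  by (intro rec_basic rec_mod rec_prod_encode dec_mem_graph_part dec_mem_range_spot rec_comp1[OF rec_k])

lemma dec_override:
  assumes "recursive_in h r b" "recursive_in h r n" "recursive_in h r v"
  shows "decidable_in h r (\<lambda>xs. override (set_decode (b xs)) (n xs) (v xs))"
proof -
  have "decidable_in h 3 (\<lambda>xs. override (set_decode (xs ! 0)) (xs ! 1) (xs ! 2))"
    unfolding override_def parent_def
    by (intro rec_basic rec_prod_encode dec_below dec_mem_graph_part dec_mem_index_part
        dec_mem_range_spot dec_comp2[OF dec_less_F]) (auto simp: nth_append)
  then show ?thesis using assms by (rule dec_comp3)
qed

lemma dec_consistent:
  assumes "recursive_in h r n" "recursive_in h r N" "recursive_in h r v" "recursive_in h r a"
    "recursive_in h r b"
  shows "decidable_in h r (\<lambda>xs. consistent (n xs) (N xs) (v xs) (a xs) (b xs))"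
  unfolding consistent_def using assms
  by (intro rec_basic rec_mod rec_prod_encode dec_override rec_comp1[OF rec_k])

lemma list_encode_tree_iff:
  "c \<in> list_encode ` tree \<longleftrightarrow> (\<forall>n<length (list_decode c). \<forall>N<length (list_decode c). odd N \<longrightarrow>
    (\<forall>v<length (list_decode c). consistent n N v (nth_code c n) (nth_code c N)))"
proof -
  have "c \<in> list_encode ` tree \<longleftrightarrow> list_decode c \<in> tree"
    by (metis image_iff list_decode_inverse list_encode_inverse)
  moreover have "nth_code c i = list_decode c ! i" if "i < length (list_decode c)" for i
    using nth_code[OF that] by simp
  ultimately show ?thesis by (auto simp: tree_def)
qed

lemma recursive_tree: "recursive_set_in h (list_encode ` tree)"
  unfolding recursive_set_in_def decidable_in_def[symmetric] list_encode_tree_iff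
  by (intro rec_basic dec_odd dec_consistent rec_nth_code rec_length_list_decode)
    (auto simp: nth_append)

lemma Pi01_range_member: "Pi01_in h (range member)"
  unfolding Pi01_in_def using seq_tree_tree recursive_tree branches_tree by metis

end

section \<open>The length of the truncations\<close>

text \<open>The largest \<open>l \<le> n\<close> with \<open>2 ^ l \<le> F n\<close>, in a form that is recursive in the oracle also where
  \<open>F n = \<infinity>\<close>.\<close>
definition level :: "(nat \<Rightarrow> enat) \<Rightarrow> nat \<Rightarrow> nat" where
  "level F n = (LEAST l. l = n \<or> F n < enat (2 ^ Suc l))"

lemma level_le: "level F n \<le> n"
  unfolding level_def by (rule Least_le) simp

lemma pow_level_le:
  assumes "F n \<noteq> 0" shows "enat (2 ^ level F n) \<le> F n"
proof (cases "level F n")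
  case 0
  then show ?thesis using assms by (simp add: Suc_ile_eq enat_0 zero_less_iff_neq_zero)
next
  case (Suc l)
  then have "\<not> (l = n \<or> F n < enat (2 ^ Suc l))"
    using not_less_Least[of l "\<lambda>l. l = n \<or> F n < enat (2 ^ Suc l)"] by (simp add: level_def)
  then show ?thesis unfolding Suc by (simp add: not_less)
qed

lemma level_tendsto:
  assumes "F \<longlonglongrightarrow> \<infinity>" shows "filterlim (level F) at_top sequentially"
  unfolding filterlim_at_top
proof
  fix b
  have "\<forall>\<^sub>F n in sequentially. enat (2 ^ b) < F n"
    using assms by (rule order_tendstoD) simp
  moreover have "\<forall>\<^sub>F n in sequentially. b \<le> n" by (rule eventually_ge_at_top)
  ultimately show "\<forall>\<^sub>F n in sequentially. b \<le> level F n"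
  proof eventually_elim
    case (elim n)
    have "level F n = n \<or> F n < enat (2 ^ Suc (level F n))"
      unfolding level_def by (rule LeastI[of _ n]) simp
    then show ?case
    proof
      assume "F n < enat (2 ^ Suc (level F n))"
      then have "enat (2 ^ b) < enat (2 ^ Suc (level F n))" using elim by (rule_tac less_trans)
      then show ?thesis by (simp del: power_Suc)
    qed (use elim in simp)
  qed
qed

lemma dec_less_enat_oracle:
  assumes "recursive_in (enat_oracle F) r a" "recursive_in (enat_oracle F) r b"
  shows "decidable_in (enat_oracle F) r (\<lambda>xs. enat (a xs) < F (b xs))"
    and "decidable_in (enat_oracle F) r (\<lambda>xs. F (b xs) < enat (a xs))"
proof -
  have *: "enat m < F n \<longleftrightarrow> enat_oracle F n = 0 \<or> Suc m < enat_oracle F n"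
    "F n < enat m \<longleftrightarrow> enat_oracle F n \<noteq> 0 \<and> enat_oracle F n \<le> m" for m n
    by (auto simp: enat_oracle_def split: enat.split)
  show "decidable_in (enat_oracle F) r (\<lambda>xs. enat (a xs) < F (b xs))"
    unfolding * using assms by (intro rec_basic rec_oracle)
  show "decidable_in (enat_oracle F) r (\<lambda>xs. F (b xs) < enat (a xs))"
    unfolding * using assms by (intro rec_basic rec_oracle)
qed

lemma rec_level: "recursive_in (enat_oracle F) 1 (\<lambda>xs. level F (xs ! 0))"
  unfolding level_def
  by (intro rec_Least rec_basic dec_less_enat_oracle) (auto simp: nth_append)

theorem theorem1p2:
  fixes F :: "nat \<Rightarrow> enat"
  assumes "\<And>n. F n \<noteq> 0"
    and "F \<longlonglongrightarrow> \<infinity>"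
  shows "\<exists>E. perfect_in (NF_topology F) E \<and> Pi01_in (enat_oracle F) E \<and>
    maximal_ev_diff_family F E"
proof -
  interpret recursive_coding F "level F" "enat_oracle F"
    using assms rec_level
    by unfold_locales
      (auto intro!: level_le pow_level_le level_tendsto dec_less_enat_oracle recursive_in.proj)
  show ?thesis using perfect_range_member Pi01_range_member maximal_range_member by blast
qed

end
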